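(* Let $r>0$. If the set $\mathcal{B}_r$ of bump functions of support radius $r$ is not empty, then the infimum $\beta(r)=\inf\{\|b\|_K : b\in\mathcal{B}_r\}$ is attained at a unique bump function $b_r^*\in\mathcal{B}_r$, i.e. there is exactly one $b_r^*\in\mathcal{B}_r$ with $\beta(r)=\|b_r^*\|_K$.
   Context: $K$ is a continuous symmetric positive definite translation-invariant real-valued kernel on $\mathbb{R}^d\times\mathbb{R}^d$, and $\mathcal{K}$ is its native space, i.e. the Hilbert space of functions on $\mathbb{R}^d$ with inner product $(\cdot,\cdot)_K$ and norm $\|\cdot\|_K$ for which $K$ is the reproducing kernel: $f(x)=(f,K(x,\cdot))_K$ for all $f\in\mathcal{K}$, $x\in\mathbb{R}^d$. The set of bump functions of support radius $r$ is $\mathcal{B}_r:=\{b\in\mathcal{K} : b(0)=1,\ b(y)=0 \text{ for all } \|y\|_2\ge r\}$. *)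

theory Defs
  imports "HOL-Analysis.Analysis"
begin

definition continuous_kernel :: "('a::topological_space \<Rightarrow> 'a \<Rightarrow> real) \<Rightarrow> bool" where
  "continuous_kernel K \<longleftrightarrow> continuous_on UNIV (\<lambda>(x, y). K x y)"

definition symmetric_kernel :: "('a \<Rightarrow> 'a \<Rightarrow> real) \<Rightarrow> bool" where
  "symmetric_kernel K \<longleftrightarrow> (\<forall>x y. K x y = K y x)"

definition translation_invariant_kernel :: "('a::ab_group_add \<Rightarrow> 'a \<Rightarrow> real) \<Rightarrow> bool" where
  "translation_invariant_kernel K \<longleftrightarrow> (\<forall>x y z. K (x + z) (y + z) = K x y)"

text \<open>
  Positive definiteness in the sense of Aronszajn and Bochner: the quadratic form of every kernel
  matrix on finitely many distinct points is nonnegative. Kernels whose kernel matrices are all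
  strictly positive definite are a special case.
\<close>

definition positive_definite_kernel :: "('a \<Rightarrow> 'a \<Rightarrow> real) \<Rightarrow> bool" where
  "positive_definite_kernel K \<longleftrightarrow>
     (\<forall>X (c :: 'a \<Rightarrow> real). finite X \<longrightarrow> 0 \<le> (\<Sum>x\<in>X. \<Sum>y\<in>X. c x * c y * K x y))"

text \<open>
  Spaces of functions are explicit carriers \<open>H\<close>, with the inner product \<open>ip\<close> a function that is
  constrained on \<open>H\<close> only.
\<close>

definition ip_norm :: "(('a \<Rightarrow> real) \<Rightarrow> ('a \<Rightarrow> real) \<Rightarrow> real) \<Rightarrow> ('a \<Rightarrow> real) \<Rightarrow> real" where
  "ip_norm ip f = sqrt (ip f f)"

locale function_hilbert_space =
  fixes H :: "('a \<Rightarrow> real) set"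
    and ip :: "('a \<Rightarrow> real) \<Rightarrow> ('a \<Rightarrow> real) \<Rightarrow> real"
  assumes zero_mem: "(\<lambda>x. 0) \<in> H"
    and add_mem: "f \<in> H \<Longrightarrow> g \<in> H \<Longrightarrow> (\<lambda>x. f x + g x) \<in> H"
    and scale_mem: "f \<in> H \<Longrightarrow> (\<lambda>x. c * f x) \<in> H"
    and ip_commute: "f \<in> H \<Longrightarrow> g \<in> H \<Longrightarrow> ip f g = ip g f"
    and ip_add_left: "f \<in> H \<Longrightarrow> g \<in> H \<Longrightarrow> h \<in> H \<Longrightarrow> ip (\<lambda>x. f x + g x) h = ip f h + ip g h"
    and ip_scale_left: "f \<in> H \<Longrightarrow> g \<in> H \<Longrightarrow> ip (\<lambda>x. c * f x) g = c * ip f g"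
    and ip_pos: "f \<in> H \<Longrightarrow> f \<noteq> (\<lambda>x. 0) \<Longrightarrow> 0 < ip f f"
    and complete:
      "\<lbrakk>\<And>n. F n \<in> H;
        \<And>e. 0 < e \<Longrightarrow> \<exists>N. \<forall>m\<ge>N. \<forall>n\<ge>N. ip_norm ip (\<lambda>x. F m x - F n x) < e\<rbrakk>
       \<Longrightarrow> \<exists>f\<in>H. (\<lambda>n. ip_norm ip (\<lambda>x. F n x - f x)) \<longlonglongrightarrow> 0"

text \<open>
  By the Moore--Aronszajn theorem, the pair \<open>(H, ip)\<close> (with \<open>ip\<close> restricted to \<open>H\<close>) exists and is
  uniquely determined by a symmetric positive definite kernel \<open>K\<close>.
\<close>

locale native_space = function_hilbert_space H ip
  for K :: "'a \<Rightarrow> 'a \<Rightarrow> real"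
    and H :: "('a \<Rightarrow> real) set"
    and ip :: "('a \<Rightarrow> real) \<Rightarrow> ('a \<Rightarrow> real) \<Rightarrow> real" +
  assumes kernel_mem: "K x \<in> H"
    and reproducing: "f \<in> H \<Longrightarrow> f x = ip f (K x)"

definition bump_functions ::
    "('a::real_normed_vector \<Rightarrow> real) set \<Rightarrow> real \<Rightarrow> ('a \<Rightarrow> real) set" where
  "bump_functions H r = {b \<in> H. b 0 = 1 \<and> (\<forall>y. r \<le> norm y \<longrightarrow> b y = 0)}"

definition min_bump_norm ::
    "('a::real_normed_vector \<Rightarrow> real) set \<Rightarrow> (('a \<Rightarrow> real) \<Rightarrow> ('a \<Rightarrow> real) \<Rightarrow> real)
      \<Rightarrow> real \<Rightarrow> real" where
  "min_bump_norm H ip r = (INF b\<in>bump_functions H r. ip_norm ip b)"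

end

theory Submission
  imports Defs
begin

text \<open>
  Norm convergence in the native space implies pointwise convergence by the reproducing property, so
  the bump functions form a closed convex set; a nonempty closed convex subset of a Hilbert space has
  a unique element of minimal norm. By the parallelogram law minimizing sequences are Cauchy, and
  two minimizers coincide.
\<close>

context function_hilbert_space
begin

lemma diff_mem:
  assumes "f \<in> H" "g \<in> H"
  shows "(\<lambda>x. f x - g x) \<in> H"
  using add_mem[OF assms(1) scale_mem[OF assms(2), of "-1"]] by simp

lemma ip_diff_left:
  assumes "f \<in> H" "g \<in> H" "h \<in> H"
  shows "ip (\<lambda>x. f x - g x) h = ip f h - ip g h"
  using ip_add_left[OF assms(1) scale_mem[OF assms(2), of "-1"] assms(3)]
    ip_scale_left[OF assms(2,3), of "-1"] by simp

lemma ip_add_right: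
  assumes "f \<in> H" "g \<in> H" "h \<in> H"
  shows "ip h (\<lambda>x. f x + g x) = ip h f + ip h g"
  using ip_add_left[OF assms] ip_commute[OF assms(3)] add_mem[OF assms(1,2)] assms by simp

lemma ip_diff_right:
  assumes "f \<in> H" "g \<in> H" "h \<in> H"
  shows "ip h (\<lambda>x. f x - g x) = ip h f - ip h g"
  using ip_diff_left[OF assms] ip_commute[OF assms(3)] diff_mem[OF assms(1,2)] assms by simp

lemma ip_scale_right:
  assumes "f \<in> H" "g \<in> H"
  shows "ip g (\<lambda>x. c * f x) = c * ip g f"
  using ip_scale_left[OF assms] ip_commute[OF assms(2)] scale_mem[OF assms(1)] assms by simp

text \<open>\<open>ip_pos\<close> speaks of nonzero functions only. For the zero function,
  homogeneity with factor 0 gives the value 0.\<close>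

lemma ip_nonneg:
  assumes "f \<in> H"
  shows "0 \<le> ip f f"
proof (cases "f = (\<lambda>x. 0)")
  case True
  then show ?thesis using ip_scale_left[OF assms assms, of 0] by simp
qed (use ip_pos[OF assms] in simp)

lemma ip_norm_nonneg: "f \<in> H \<Longrightarrow> 0 \<le> ip_norm ip f"
  by (simp add: ip_norm_def ip_nonneg)

lemma ip_norm_square: "f \<in> H \<Longrightarrow> (ip_norm ip f)\<^sup>2 = ip f f"
  by (simp add: ip_norm_def ip_nonneg)

lemma ip_self_eq_0_imp: "f \<in> H \<Longrightarrow> ip f f = 0 \<Longrightarrow> f = (\<lambda>x. 0)"
  using ip_pos[of f] by (cases "f = (\<lambda>x. 0)") simp_all

text \<open>Subtract from \<open>f\<close> its orthogonal projection onto the line spanned by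
  \<open>g\<close>; the remainder has nonnegative squared norm. The projection coefficient divides
  by \<open>ip g g\<close>, so a vanishing \<open>g\<close> is treated apart.\<close>

lemma Cauchy_Schwarz_ip_norm:
  assumes f: "f \<in> H" and g: "g \<in> H"
  shows "\<bar>ip f g\<bar> \<le> ip_norm ip f * ip_norm ip g"
proof (cases "ip g g = 0")
  case True
  then have "g = (\<lambda>x. 0)" by (rule ip_self_eq_0_imp[OF g])
  then have "ip g f = 0" using ip_scale_left[OF f f, of 0] by simp
  then show ?thesis using ip_commute[OF f g] ip_norm_nonneg f g by simp
next
  case False
  then have pos: "0 < ip g g" using ip_nonneg[OF g] by simp
  \<comment> \<open>The coefficient of the projection of \<open>f\<close> onto \<open>g\<close>,
    which minimizes the squared norm of \<open>f - t * g\<close>.\<close>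
  define t where "t = ip f g / ip g g"
  have tg: "(\<lambda>x. t * g x) \<in> H" using scale_mem[OF g] .
  have "0 \<le> ip (\<lambda>x. f x - t * g x) (\<lambda>x. f x - t * g x)"
    using ip_nonneg[OF diff_mem[OF f tg]] .
  also have "\<dots> = ip f f - 2 * t * ip f g + t\<^sup>2 * ip g g"
    using ip_commute[OF f g]
    by (simp add: ip_diff_left ip_diff_right ip_scale_left ip_scale_right f g tg diff_mem
        power2_eq_square algebra_simps)
  also have "\<dots> = ip f f - (ip f g)\<^sup>2 / ip g g"
    using pos by (simp add: t_def power2_eq_square)
  finally have "(ip f g)\<^sup>2 \<le> ip f f * ip g g"
    using pos by (simp add: field_simps)
  then have "(ip f g)\<^sup>2 \<le> (ip_norm ip f * ip_norm ip g)\<^sup>2"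
    by (simp add: power_mult_distrib ip_norm_square f g)
  then show ?thesis
    using ip_norm_nonneg f g by (simp add: power2_le_iff_abs_le)
qed

text \<open>Expand the square of \<open>f = g - (g - f)\<close> and bound the cross term by
  Cauchy-Schwarz. With \<open>g\<close> a sequence member and \<open>f\<close> its limit, the
  difference has the orientation used in \<open>complete\<close>.\<close>

lemma ip_norm_triangle_ineq:
  assumes f: "f \<in> H" and g: "g \<in> H"
  shows "ip_norm ip f \<le> ip_norm ip g + ip_norm ip (\<lambda>x. g x - f x)"
proof (rule power2_le_imp_le)
  let ?d = "\<lambda>x. g x - f x"
  have d: "?d \<in> H" using diff_mem[OF g f] .
  have "ip f f = ip g g - 2 * ip g ?d + ip ?d ?d"
    using ip_commute[OF f g] by (simp add: ip_diff_left ip_diff_right f g d)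
  then show "(ip_norm ip f)\<^sup>2 \<le> (ip_norm ip g + ip_norm ip ?d)\<^sup>2"
    using Cauchy_Schwarz_ip_norm[OF g d] by (simp add: power2_sum ip_norm_square f g d)
  show "0 \<le> ip_norm ip g + ip_norm ip ?d" using ip_norm_nonneg g d by simp
qed

text \<open>The parallelogram law, with the squared norm of \<open>f + g\<close> written as four
  times that of the midpoint: in a convex set the midpoint is again a member, so its norm is bounded
  below by the infimum.\<close>

lemma parallelogram_midpoint:
  assumes f: "f \<in> H" and g: "g \<in> H"
  shows "ip (\<lambda>x. f x - g x) (\<lambda>x. f x - g x) =
    2 * ip f f + 2 * ip g g - 4 * ip (\<lambda>x. (1/2) * (f x + g x)) (\<lambda>x. (1/2) * (f x + g x))"
  using ip_commute[OF f g] scale_mem[OF add_mem[OF f g], of "1/2"]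
  by (simp only: ip_diff_left ip_diff_right ip_add_left ip_add_right ip_scale_left ip_scale_right
      f g diff_mem add_mem) (simp add: field_simps)

text \<open>Projection of the origin onto a closed convex set. Convexity is expressed through
  midpoints, the form that the parallelogram law uses, and closedness through norm-convergent
  sequences with limit in \<open>H\<close>.\<close>

theorem unique_min_norm:
  assumes sub: "C \<subseteq> H" and ne: "C \<noteq> {}"
    and mid: "\<And>f g. f \<in> C \<Longrightarrow> g \<in> C \<Longrightarrow> (\<lambda>x. (1/2) * (f x + g x)) \<in> C"
    and closed: "\<And>F f. (\<And>n. F n \<in> C) \<Longrightarrow> f \<in> H \<Longrightarrow>
      (\<lambda>n. ip_norm ip (\<lambda>x. F n x - f x)) \<longlonglongrightarrow> 0 \<Longrightarrow> f \<in> C"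
  shows "\<exists>!b. b \<in> C \<and> (INF b\<in>C. ip_norm ip b) = ip_norm ip b"
proof -
  define m where "m = (INF b\<in>C. ip_norm ip b)"
  have bdd: "bdd_below (ip_norm ip ` C)"
    using sub ip_norm_nonneg by (auto intro!: bdd_belowI[of _ 0])
  have m_le: "m \<le> ip_norm ip b" if "b \<in> C" for b
    unfolding m_def using bdd that by (rule cINF_lower)
  have m_nonneg: "0 \<le> m"
    unfolding m_def using ne sub ip_norm_nonneg by (auto intro!: cINF_greatest)
  \<comment> \<open>The key estimate: members with norms close to the infimum are close to each
    other. It serves both the Cauchy property and uniqueness.\<close>
  have near: "(ip_norm ip (\<lambda>x. f x - g x))\<^sup>2 \<le> 2 * (ip_norm ip f)\<^sup>2 + 2 * (ip_norm ip g)\<^sup>2 - 4 * m\<^sup>2"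
    if f: "f \<in> C" and g: "g \<in> C" for f g
  proof -
    let ?h = "\<lambda>x. (1/2) * (f x + g x)"
    have h: "?h \<in> C" using mid f g by blast
    have H: "f \<in> H" "g \<in> H" "?h \<in> H" using f g h sub by auto
    have "m\<^sup>2 \<le> (ip_norm ip ?h)\<^sup>2" using m_le[OF h] m_nonneg by (rule power_mono)
    then show ?thesis
      unfolding ip_norm_square[OF H(1)] ip_norm_square[OF H(2)] ip_norm_square[OF H(3)]
        ip_norm_square[OF diff_mem[OF H(1,2)]] parallelogram_midpoint[OF H(1,2)]
      by linarith
  qed
  \<comment> \<open>Choice of a minimizing sequence.\<close>
  have "\<exists>f\<in>C. ip_norm ip f < m + inverse (real (Suc n))" for n
    using cINF_less_iff[OF ne bdd, of "m + inverse (real (Suc n))"]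
    unfolding m_def[symmetric] by simp
  then obtain F where F: "\<And>n. F n \<in> C" and F_less: "\<And>n. ip_norm ip (F n) < m + inverse (real (Suc n))"
    by metis
  have lim: "(\<lambda>n. ip_norm ip (F n)) \<longlonglongrightarrow> m"
  proof (rule tendsto_sandwich)
    show "(\<lambda>n. m) \<longlonglongrightarrow> m" by simp
    show "(\<lambda>n. m + inverse (real (Suc n))) \<longlonglongrightarrow> m"
      using tendsto_add[OF tendsto_const LIMSEQ_inverse_real_of_nat, of m] by simp
  qed (use m_le[OF F] F_less in \<open>auto intro!: always_eventually less_imp_le\<close>)
  have "\<exists>f\<in>H. (\<lambda>n. ip_norm ip (\<lambda>x. F n x - f x)) \<longlonglongrightarrow> 0"
  proof (rule complete)
    show "F n \<in> H" for n using F sub by blast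
    fix e :: real assume e: "0 < e"
    \<comment> \<open>The margin \<open>e\<^sup>2 / 4\<close> is what \<open>near\<close> asks for:
      both squared norms enter with factor 2, so the excesses over \<open>m\<^sup>2\<close> add up
      to less than \<open>e\<^sup>2\<close>.\<close>
    have "(\<lambda>n. (ip_norm ip (F n))\<^sup>2) \<longlonglongrightarrow> m\<^sup>2" using lim by (rule tendsto_power)
    then have "\<forall>\<^sub>F n in sequentially. (ip_norm ip (F n))\<^sup>2 < m\<^sup>2 + e\<^sup>2 / 4"
      by (rule order_tendstoD) (use e in simp)
    then obtain N where N: "\<And>n. n \<ge> N \<Longrightarrow> (ip_norm ip (F n))\<^sup>2 < m\<^sup>2 + e\<^sup>2 / 4"
      unfolding eventually_sequentially by blast
    have "ip_norm ip (\<lambda>x. F k x - F n x) < e" if "k \<ge> N" "n \<ge> N" for k n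
    proof (rule power2_less_imp_less)
      show "(ip_norm ip (\<lambda>x. F k x - F n x))\<^sup>2 < e\<^sup>2"
        using near[OF F F, of k n] N[OF that(1)] N[OF that(2)] by linarith
    qed (use e in simp)
    then show "\<exists>N. \<forall>k\<ge>N. \<forall>n\<ge>N. ip_norm ip (\<lambda>x. F k x - F n x) < e" by blast
  qed
  then obtain f where fH: "f \<in> H" and conv: "(\<lambda>n. ip_norm ip (\<lambda>x. F n x - f x)) \<longlonglongrightarrow> 0"
    by blast
  have fC: "f \<in> C" using closed[OF F fH conv] .
  \<comment> \<open>The limit does not exceed the infimum: let n tend to infinity in the triangle
    inequality. The converse bound is membership of \<open>f\<close> in \<open>C\<close>.\<close>
  have "ip_norm ip f \<le> m + 0"
  proof (rule LIMSEQ_le_const)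
    show "(\<lambda>n. ip_norm ip (F n) + ip_norm ip (\<lambda>x. F n x - f x)) \<longlonglongrightarrow> m + 0"
      using lim conv by (rule tendsto_add)
    show "\<exists>N. \<forall>n\<ge>N. ip_norm ip f \<le> ip_norm ip (F n) + ip_norm ip (\<lambda>x. F n x - f x)"
      using ip_norm_triangle_ineq[OF fH] F sub by blast
  qed
  with m_le[OF fC] have f_min: "m = ip_norm ip f" by simp
  have "g = f" if g: "g \<in> C" and g_min: "m = ip_norm ip g" for g
  proof -
    have dH: "(\<lambda>x. g x - f x) \<in> H" using g fC sub by (auto intro: diff_mem)
    \<comment> \<open>For two minimizers the right side of \<open>near\<close> is
      \<open>2 * m\<^sup>2 + 2 * m\<^sup>2 - 4 * m\<^sup>2\<close>, which is 0.\<close>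
    have "ip (\<lambda>x. g x - f x) (\<lambda>x. g x - f x) \<le> 0"
      using near[OF g fC] unfolding ip_norm_square[OF dH] g_min[symmetric] f_min[symmetric] by simp
    then have "(\<lambda>x. g x - f x) = (\<lambda>x. 0)"
      using ip_pos[OF dH] by linarith
    then show "g = f" by (simp add: fun_eq_iff)
  qed
  with fC f_min show ?thesis unfolding m_def[symmetric] by blast
qed

end

text \<open>Evaluation at \<open>x\<close> is the inner product with \<open>K x\<close>, hence by
  Cauchy-Schwarz a bounded functional with bound \<open>ip_norm ip (K x)\<close>.\<close>

lemma (in native_space) pointwise_convergence:
  assumes F: "\<And>n. F n \<in> H" and f: "f \<in> H"
    and conv: "(\<lambda>n. ip_norm ip (\<lambda>x. F n x - f x)) \<longlonglongrightarrow> 0"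
  shows "(\<lambda>n. F n x) \<longlonglongrightarrow> f x"
proof -
  have "\<bar>F n x - f x\<bar> \<le> ip_norm ip (\<lambda>x. F n x - f x) * ip_norm ip (K x)" for n
  proof -
    have d: "(\<lambda>x. F n x - f x) \<in> H" using F f by (rule diff_mem)
    show ?thesis
      using Cauchy_Schwarz_ip_norm[OF d kernel_mem[of x]]
      unfolding reproducing[OF d, of x, symmetric] .
  qed
  then have "\<forall>\<^sub>F n in sequentially.
      norm (F n x - f x) \<le> ip_norm ip (\<lambda>x. F n x - f x) * ip_norm ip (K x)"
    by simp
  then have "(\<lambda>n. F n x - f x) \<longlonglongrightarrow> 0"
    using tendsto_mult_left_zero[OF conv] by (rule Lim_null_comparison)
  then show ?thesis by (rule LIM_zero_cancel)
qed

theorem theorem3: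
  fixes K :: "real ^ 'd \<Rightarrow> real ^ 'd \<Rightarrow> real"
    and H :: "(real ^ 'd \<Rightarrow> real) set"
    and ip :: "(real ^ 'd \<Rightarrow> real) \<Rightarrow> (real ^ 'd \<Rightarrow> real) \<Rightarrow> real"
    and r :: real
  assumes "continuous_kernel K"
    and "symmetric_kernel K"
    and "positive_definite_kernel K"
    and "translation_invariant_kernel K"
    and "native_space K H ip"
    and "r > 0"
    and "bump_functions H r \<noteq> {}"
  shows "\<exists>!b. b \<in> bump_functions H r \<and> min_bump_norm H ip r = ip_norm ip b"
proof -
  interpret native_space K H ip by fact
  show ?thesis
    unfolding min_bump_norm_def
  proof (rule unique_min_norm)
    show "bump_functions H r \<subseteq> H" by (auto simp: bump_functions_def)
    show "bump_functions H r \<noteq> {}" by fact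
  next
    fix f g assume "f \<in> bump_functions H r" "g \<in> bump_functions H r"
    \<comment> \<open>The constraints prescribe values at points, 1 at the origin and 0 outside the
      ball, and averaging preserves equal values.\<close>
    then show "(\<lambda>x. (1/2) * (f x + g x)) \<in> bump_functions H r"
      using scale_mem[OF add_mem, of f g "1/2"] by (simp add: bump_functions_def)
  next
    fix F f
    assume F: "\<And>n. F n \<in> bump_functions H r" and f: "f \<in> H"
      and conv: "(\<lambda>n. ip_norm ip (\<lambda>x. F n x - f x)) \<longlonglongrightarrow> 0"
    \<comment> \<open>At each constrained point the sequence of values is constant, so its pointwise
      limit \<open>f\<close> inherits the prescribed value.\<close>
    have lim: "(\<lambda>n. F n x) \<longlonglongrightarrow> f x" for x
      using pointwise_convergence[OF _ f conv] F by (simp add: bump_functions_def)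
    have "f 0 = 1"
      using lim[of 0] F by (simp add: bump_functions_def LIMSEQ_const_iff)
    moreover have "f y = 0" if "r \<le> norm y" for y
      using lim[of y] F that by (simp add: bump_functions_def LIMSEQ_const_iff)
    ultimately show "f \<in> bump_functions H r"
      using f by (simp add: bump_functions_def)
  qed
qed

end
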